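(* Let $F=\mathbb{F}_q$ be a finite field, let $m\ge 1$, and let $R=F[x]/\langle x^m-1\rangle$. Let $C\subseteq R^2$ be a quasi-cyclic code of length $2m$ and index $2$, generated by $g_1=(g_{11}(x),g_{12}(x))$ and $g_2=(0,g_{22}(x))$, where $g_{11},g_{12},g_{22}\in F[x]$ satisfy: $g_{11}(x)\mid (x^m-1)$ and $g_{22}(x)\mid (x^m-1)$; $\deg g_{12}(x)<\deg g_{22}(x)$; and $g_{11}(x)g_{22}(x)\mid (x^m-1)g_{12}(x)$. Then $C$ is (Euclidean) self-orthogonal, i.e. $C\subseteq C^{\perp_e}$, if and only if the following conditions hold: 1) $g_{22}(x)g_{22}(x)^\circ\equiv 0\pmod{x^m-1}$; 2) $g_{12}(x)g_{22}(x)^\circ\equiv 0\pmod{x^m-1}$; 3) $g_{11}(x)g_{11}(x)^\circ+g_{12}(x)g_{12}(x)^\circ\equiv 0\pmod{x^m-1}$.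
   Context: A quasi-cyclic code of length $2m$ and index $2$ over $F$ (a linear subspace of $F^{2m}$ invariant under the square of the cyclic shift) is identified with an $R$-submodule of $R^2$: a vector $(c_{0,0},c_{0,1},c_{1,0},c_{1,1},\dots,c_{m-1,0},c_{m-1,1})$ corresponds to $(c_0(x),c_1(x))$ with $c_j(x)=\sum_{i=0}^{m-1} c_{i,j}x^i$. "Generated by" means generated as an $R$-module; polynomials are also regarded as elements of $R$ by reduction modulo $x^m-1$. Divisibility is in $F[x]$; convention $\deg 0=-\infty$, so $g_{12}=0$ is allowed. For $f(x)\in F[x]$ with $\deg f\le m$, the transpose polynomial is $f(x)^\circ=x^m f(x^{-1})\in F[x]$. For $a=\sum_{i=0}^{m-1}a_ix^i$, $b=\sum_{i=0}^{m-1}b_ix^i$ in $R$, $\langle a,b\rangle_e=\sum_{i=0}^{m-1}a_ib_i$, and $\langle (a,b),(a',b')\rangle_e=\langle a,a'\rangle_e+\langle b,b'\rangle_e$ on $R^2$. $C^{\perp_e}=\{u\in R^2: \langle u,v\rangle_e=0 \text{ for all } v\in C\}$. *)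

theory Defs
  imports
    "HOL-Algebra.QuotRing"
    "HOL-Algebra.Module"
    "HOL-Computational_Algebra.Polynomial"
    "HOL-Number_Theory.Cong"
begin

text \<open>\<open>F[x]\<close> as a ring record, so that the quotient by an ideal can be formed.\<close>

definition poly_ring_rec :: "'a::field poly ring" where
  "poly_ring_rec = \<lparr>carrier = UNIV, monoid.mult = (*), one = 1, zero = 0, add = (+)\<rparr>"

definition xm1 :: "nat \<Rightarrow> 'a::field poly" where
  "xm1 m = monom 1 m - 1"

abbreviation xm1_ideal :: "nat \<Rightarrow> 'a::field poly set" where
  "xm1_ideal m \<equiv> PIdl\<^bsub>poly_ring_rec\<^esub> (xm1 m)"

definition quot_ring :: "nat \<Rightarrow> 'a::field poly set ring" where
  "quot_ring m = poly_ring_rec Quot (xm1_ideal m)"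

definition residue_class :: "nat \<Rightarrow> 'a::field poly \<Rightarrow> 'a poly set" where
  "residue_class m p = xm1_ideal m +>\<^bsub>poly_ring_rec\<^esub> p"

text \<open>The representative \<open>\<Sum>i<m. a\<^sub>i x\<^sup>i\<close> of an element of \<open>R = quot_ring m\<close>; unique for \<open>m \<ge> 1\<close>.\<close>

definition reduced_rep :: "nat \<Rightarrow> 'a::field poly set \<Rightarrow> 'a poly" where
  "reduced_rep m a = (THE p. p \<in> a \<and> degree p < m)"

text \<open>\<open>R\<^sup>2\<close> as an \<open>R\<close>-module. The record type also asks for \<open>mult\<close> and \<open>one\<close>, which the notions
  of module and submodule ignore.\<close>

definition quot_plane :: "nat \<Rightarrow> ('a::field poly set, 'a poly set \<times> 'a poly set) module" where
  "quot_plane m =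
     \<lparr>carrier = carrier (quot_ring m) \<times> carrier (quot_ring m),
      monoid.mult = (\<lambda>(a, b) (c, d). (a \<otimes>\<^bsub>quot_ring m\<^esub> c, b \<otimes>\<^bsub>quot_ring m\<^esub> d)),
      one = (\<one>\<^bsub>quot_ring m\<^esub>, \<one>\<^bsub>quot_ring m\<^esub>),
      zero = (\<zero>\<^bsub>quot_ring m\<^esub>, \<zero>\<^bsub>quot_ring m\<^esub>),
      add = (\<lambda>(a, b) (c, d). (a \<oplus>\<^bsub>quot_ring m\<^esub> c, b \<oplus>\<^bsub>quot_ring m\<^esub> d)),
      module.smult = (\<lambda>r (a, b). (r \<otimes>\<^bsub>quot_ring m\<^esub> a, r \<otimes>\<^bsub>quot_ring m\<^esub> b))\<rparr>"

definition generated_submodule ::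
    "nat \<Rightarrow> ('a::field poly set \<times> 'a poly set) set \<Rightarrow> ('a poly set \<times> 'a poly set) set" where
  "generated_submodule m S = (\<lambda>N. submodule N (quot_ring m) (quot_plane m)) hull S"

definition linear_code :: "nat \<Rightarrow> 'a::field list set \<Rightarrow> bool" where
  "linear_code n W \<longleftrightarrow> W \<subseteq> {v. length v = n} \<and> replicate n 0 \<in> W
     \<and> (\<forall>v\<in>W. \<forall>w\<in>W. map2 (+) v w \<in> W) \<and> (\<forall>c. \<forall>v\<in>W. map ((*) c) v \<in> W)"

definition cyclic_shift :: "'a list \<Rightarrow> 'a list" where
  "cyclic_shift v = last v # butlast v"

definition quasi_cyclic_code :: "nat \<Rightarrow> nat \<Rightarrow> 'a::field list set \<Rightarrow> bool" where
  "quasi_cyclic_code n l W \<longleftrightarrow> linear_code n W \<and> (cyclic_shift ^^ l) ` W \<subseteq> W"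

text \<open>The word \<open>(c\<^bsub>0,0\<^esub>, c\<^bsub>0,1\<^esub>, \<dots>, c\<^bsub>m-1,0\<^esub>, c\<^bsub>m-1,1\<^esub>)\<close> identified with the pair \<open>(c\<^sub>0, c\<^sub>1)\<close> of \<open>R\<^sup>2\<close>.\<close>

definition codeword :: "nat \<Rightarrow> 'a::field poly set \<times> 'a poly set \<Rightarrow> 'a list" where
  "codeword m u = concat (map (\<lambda>i. [coeff (reduced_rep m (fst u)) i, coeff (reduced_rep m (snd u)) i]) [0..<m])"

definition euclid :: "nat \<Rightarrow> 'a::field poly set \<Rightarrow> 'a poly set \<Rightarrow> 'a" where
  "euclid m a b = (\<Sum>i<m. coeff (reduced_rep m a) i * coeff (reduced_rep m b) i)"

definition euclid2 :: "nat \<Rightarrow> 'a::field poly set \<times> 'a poly set \<Rightarrow> 'a poly set \<times> 'a poly set \<Rightarrow> 'a" where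
  "euclid2 m u v = euclid m (fst u) (fst v) + euclid m (snd u) (snd v)"

definition euclid_dual ::
    "nat \<Rightarrow> ('a::field poly set \<times> 'a poly set) set \<Rightarrow> ('a poly set \<times> 'a poly set) set" where
  "euclid_dual m C = {u \<in> carrier (quot_plane m). \<forall>v\<in>C. euclid2 m u v = 0}"

text \<open>\<open>x\<^sup>m f(x\<^sup>-\<^sup>1)\<close>, a polynomial when \<open>degree f \<le> m\<close>; only used in that range.\<close>

definition transpose_poly :: "nat \<Rightarrow> 'a::field poly \<Rightarrow> 'a poly" where
  "transpose_poly m f = (\<Sum>i\<le>degree f. monom (coeff f i) (m - i))"

end

theory Submission
  imports Defs
begin

text \<open>Modulo \<open>x^m - 1\<close> the transpose of \<open>f\<close> is the image \<open>f*\<close> of \<open>f\<close> under the ring homomorphism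
  \<open>x \<mapsto> x^(m-1)\<close>, which is an involution modulo \<open>x^m - 1\<close>. The Euclidean form of \<open>u\<close> and \<open>v\<close> is the
  constant coefficient of \<open>u v*\<close> reduced modulo \<open>x^m - 1\<close>, and a polynomial all of whose multiples
  have constant coefficient \<open>0\<close> after reduction is divisible by \<open>x^m - 1\<close>. Self-orthogonality of
  the code thus says that the Hermitian products \<open>u\<^sub>1 v\<^sub>1* + u\<^sub>2 v\<^sub>2*\<close> of codewords vanish modulo
  \<open>x^m - 1\<close>, and by sesquilinearity it suffices to know this for the two generators.\<close>

section \<open>Reduction modulo \<open>x^m - 1\<close>\<close>

lemma degree_xm1:
  assumes "m \<ge> 1"
  shows "degree (xm1 m :: 'a::field poly) = m"
proof -
  have "degree (monom 1 m + (- 1) :: 'a poly) = degree (monom 1 m :: 'a poly)"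
    using assms by (intro degree_add_eq_left) (simp add: degree_monom_eq)
  then show ?thesis by (simp add: xm1_def degree_monom_eq)
qed

lemma xm1_neq_0:
  assumes "m \<ge> 1"
  shows "(xm1 m :: 'a::field poly) \<noteq> 0"
  using degree_xm1[OF assms, where 'a='a] assms by auto

lemma degree_mod_xm1_less:
  assumes "m \<ge> 1"
  shows "degree (p mod xm1 m :: 'a::field poly) < m"
  using degree_mod_less[OF xm1_neq_0[OF assms], of p] degree_xm1[OF assms, where 'a='a] assms
  by auto

lemma cong_monom_period: "[monom a (i + m * k) = monom a i] (mod (xm1 m :: 'a::field poly))"
proof -
  have "[monom 1 m = 1] (mod (xm1 m :: 'a poly))"
    by (simp add: cong_iff_dvd_diff xm1_def)
  from cong_scalar_left[OF cong_pow[OF this, of k], of "monom a i"] show ?thesis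
    by (simp add: monom_power mult_monom)
qed

lemma monom_mod_xm1:
  assumes "m \<ge> 1"
  shows "monom a n mod xm1 m = (monom a (n mod m) :: 'a::field poly)"
proof -
  have "[monom a (n mod m + m * (n div m)) = monom a (n mod m)] (mod (xm1 m :: 'a poly))"
    by (rule cong_monom_period)
  moreover have "degree (monom a (n mod m) :: 'a poly) < degree (xm1 m :: 'a poly)"
    using degree_monom_le[of a "n mod m"] assms by (simp add: degree_xm1 le_less_trans)
  ultimately show ?thesis
    by (simp add: cong_def mod_poly_less)
qed

text \<open>A linear functional on \<open>R\<close>, stated on polynomials. It plays the role of a
  trace: for \<open>m \<ge> 1\<close> its kernel contains no nonzero ideal of \<open>R\<close>,
  which lets scalar equations be traded for divisibility.\<close>

definition const_mod :: "nat \<Rightarrow> 'a::field poly \<Rightarrow> 'a" where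
  "const_mod m p = coeff (p mod xm1 m) 0"

lemma const_mod_cong: "[p = q] (mod xm1 m) \<Longrightarrow> const_mod m p = const_mod m q"
  by (simp add: const_mod_def cong_def)

lemma const_mod_add: "const_mod m (p + q) = const_mod m p + const_mod m q"
  by (simp add: const_mod_def poly_mod_add_left)

lemma const_mod_smult: "const_mod m (smult c p) = c * const_mod m p"
  by (simp add: const_mod_def mod_smult_left)

lemma const_mod_sum: "const_mod m (sum f A) = (\<Sum>i\<in>A. const_mod m (f i))"
  by (induction A rule: infinite_finite_induct)
    (simp_all add: const_mod_add, simp_all add: const_mod_def)

lemma const_mod_monom:
  assumes "m \<ge> 1"
  shows "const_mod m (monom a n) = (if m dvd n then a else 0)"
  using assms by (auto simp: const_mod_def monom_mod_xm1 dvd_eq_mod_eq_0)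

lemma poly_eq_sum_monom_lessThan:
  assumes "degree p < m"
  shows "p = (\<Sum>i<m. monom (coeff p i) i)"
proof -
  have "{..<m} = {..m - 1}" using assms by auto
  then show ?thesis using poly_as_sum_of_monoms'[of p "m - 1"] assms by simp
qed

text \<open>Since \<open>(m - 1) * j\<close> is -j modulo m, the monomial acts as x^(-j) and rotates
  coefficient j into position 0.\<close>

lemma const_mod_mult_monom:
  assumes "j < m"
  shows "const_mod m (p * monom 1 ((m - 1) * j)) = coeff (p mod xm1 m) j"
proof -
  have m: "m \<ge> 1" using assms by simp
  \<comment> \<open>The exponent differs from i - j by a multiple of m, and |i - j| < m. Integers
    are used because i - j may be negative.\<close>
  have iff: "m dvd i + (m - 1) * j \<longleftrightarrow> i = j" if "i < m" for i
  proof -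
    have "int (i + (m - 1) * j) = int i + (int m - 1) * int j"
      using m by (simp add: of_nat_diff)
    then have "int (i + (m - 1) * j) = int m * int j + (int i - int j)"
      by (simp add: algebra_simps)
    then have "m dvd i + (m - 1) * j \<longleftrightarrow> int m dvd int i - int j"
      by (metis dvd_add_right_iff dvd_triv_left int_dvd_int_iff)
    also have "\<dots> \<longleftrightarrow> i = j"
      using that assms by (simp add: mod_eq_dvd_iff[symmetric])
    finally show ?thesis .
  qed
  let ?p = "p mod xm1 m"
  have "const_mod m (p * monom 1 ((m - 1) * j)) = const_mod m (?p * monom 1 ((m - 1) * j))"
    by (rule const_mod_cong) (simp add: cong_def mod_mult_left_eq)
  also have "?p * monom 1 ((m - 1) * j) = (\<Sum>i<m. monom (coeff ?p i) (i + (m - 1) * j))"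
    by (subst poly_eq_sum_monom_lessThan[OF degree_mod_xm1_less[OF m]])
      (simp add: sum_distrib_right mult_monom)
  also have "const_mod m \<dots> = (\<Sum>i<m. if i = j then coeff ?p i else 0)"
    unfolding const_mod_sum by (intro sum.cong refl) (simp only: const_mod_monom[OF m] iff lessThan_iff)
  also have "\<dots> = coeff ?p j"
    using assms by simp
  finally show ?thesis .
qed

text \<open>For the converse, letting r run through the powers of x^(m-1) already reads off every
  coefficient of the remainder of p.\<close>

lemma xm1_dvd_iff_const_mod:
  assumes "m \<ge> 1"
  shows "xm1 m dvd p \<longleftrightarrow> (\<forall>r. const_mod m (r * p) = 0)"
proof
  assume "xm1 m dvd p"
  then show "\<forall>r. const_mod m (r * p) = 0"
    by (simp add: const_mod_def mod_eq_0_iff_dvd)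
next
  assume *: "\<forall>r. const_mod m (r * p) = 0"
  have "coeff (p mod xm1 m) j = 0" for j
  proof (cases "j < m")
    case True
    then show ?thesis using * const_mod_mult_monom[of j m p] by (metis mult.commute)
  next
    case False
    then show ?thesis using degree_mod_xm1_less[OF assms, of p] by (simp add: coeff_eq_0)
  qed
  then show "xm1 m dvd p" by (simp add: poly_eq_iff dvd_eq_mod_eq_0)
qed

section \<open>Conjugation\<close>

text \<open>Modulo x^m - 1 the inverse of x is x^(m-1), so this is the substitution of x^(-1) for x
  without leaving \<open>F[x]\<close>. As a composition it is multiplicative exactly, not only
  modulo x^m - 1.\<close>

definition conj_poly :: "nat \<Rightarrow> 'a::field poly \<Rightarrow> 'a poly" where
  "conj_poly m p = pcompose p (monom 1 (m - 1))"

lemma conj_add: "conj_poly m (p + q) = conj_poly m p + conj_poly m q"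
  by (simp add: conj_poly_def pcompose_add)

lemma conj_mult: "conj_poly m (p * q) = conj_poly m p * conj_poly m q"
  by (simp add: conj_poly_def pcompose_mult)

lemma pcompose_monom_monom: "pcompose (monom a i) (monom 1 n) = monom (a::'a::field) (n * i)"
  by (induction i) (simp_all add: monom_0 monom_Suc pcompose_pCons mult_monom)

lemma conj_monom: "conj_poly m (monom a i) = monom a ((m - 1) * i)"
  by (simp add: conj_poly_def pcompose_monom_monom)

lemma conj_sum: "conj_poly m (sum f A) = (\<Sum>i\<in>A. conj_poly m (f i))"
  by (simp add: conj_poly_def pcompose_sum)

text \<open>The conjugate is x^(m(m-1)) - 1. This divisibility is what makes conjugation well
  defined on \<open>R\<close>.\<close>

lemma xm1_dvd_conj_xm1: "xm1 m dvd (conj_poly m (xm1 m) :: 'a::field poly)"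
proof -
  have "conj_poly m (xm1 m) = monom 1 (0 + m * (m - 1)) - (monom 1 0 :: 'a poly)"
    by (simp add: xm1_def conj_poly_def pcompose_diff pcompose_1 pcompose_monom_monom mult.commute)
  then show ?thesis
    using cong_monom_period[of 1 0 m "m - 1"] by (simp only: cong_iff_dvd_diff)
qed

lemma conj_cong:
  assumes "[p = q] (mod xm1 m)"
  shows "[conj_poly m p = conj_poly m q] (mod xm1 m)"
proof -
  from assms obtain k where "p - q = xm1 m * k"
    by (auto simp: cong_iff_dvd_diff)
  then have "conj_poly m p - conj_poly m q = conj_poly m (xm1 m) * conj_poly m k"
    by (metis conj_poly_def conj_mult pcompose_diff)
  then show ?thesis
    using dvd_mult2[OF xm1_dvd_conj_xm1] by (simp add: cong_iff_dvd_diff)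
qed

lemma conj_conj_cong:
  assumes "m \<ge> 1"
  shows "[conj_poly m (conj_poly m p) = p] (mod xm1 m)"
proof -
  \<comment> \<open>This is (m-1)^2 = 1 + m(m-2), where truncated subtraction forces m to be at
    least 2. For m = 1 every monomial is congruent to its coefficient.\<close>
  have exp: "(m - 1) * ((m - 1) * i) = i + m * ((m - 2) * i)" if "m \<ge> 2" for i
  proof -
    obtain k where "m = k + 2" using \<open>m \<ge> 2\<close> by (metis add.commute le_Suc_ex)
    then show ?thesis by (simp add: algebra_simps)
  qed
  have "[conj_poly m (conj_poly m (monom a i)) = monom a i] (mod xm1 m)" for a :: 'a and i
  proof (cases "m \<ge> 2")
    case True
    then show ?thesis
      using cong_monom_period[of a i m "(m - 2) * i"] by (simp only: conj_monom exp)
  next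
    case False
    with assms have "m = 1" by simp
    then show ?thesis
      using cong_sym[OF cong_monom_period[of a 0 1 i]] by (simp add: conj_monom)
  qed
  then have "[(\<Sum>i\<le>degree p. conj_poly m (conj_poly m (monom (coeff p i) i)))
      = (\<Sum>i\<le>degree p. monom (coeff p i) i)] (mod xm1 m)"
    by (intro cong_sum)
  then show ?thesis
    by (simp only: conj_sum[symmetric] poly_as_sum_of_monoms)
qed

text \<open>The exponents \<open>m - i\<close> and \<open>(m - 1) * i\<close> both represent -i
  modulo m; the degree bound keeps \<open>m - i\<close> from being truncated.\<close>

lemma transpose_cong_conj:
  assumes "degree f \<le> m"
  shows "[transpose_poly m f = conj_poly m f] (mod xm1 m)"
proof -
  have "[monom (coeff f i) (m - i) = conj_poly m (monom (coeff f i) i)] (mod xm1 m)"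
    if "i \<le> degree f" for i
  \<comment> \<open>For i = 0 the transpose has the larger exponent, m against 0. For positive i the
    conjugate exceeds it by m(i-1), so the period is applied in the other direction.\<close>
  proof (cases "i = 0")
    case True
    then show ?thesis
      using cong_monom_period[of "coeff f 0" 0 m 1] by (simp add: conj_monom)
  next
    case False
    have "i \<le> m" using that assms by simp
    with False obtain k l where "i = Suc k" "m = i + l"
      by (metis le_Suc_ex not0_implies_Suc)
    then have "(m - 1) * i = (m - i) + m * (i - 1)"
      by (simp add: algebra_simps)
    then show ?thesis
      using cong_sym[OF cong_monom_period[of "coeff f i" "m - i" m "i - 1"]]
      by (simp only: conj_monom)
  qed
  then have "[transpose_poly m f = (\<Sum>i\<le>degree f. conj_poly m (monom (coeff f i) i))] (mod xm1 m)"
    unfolding transpose_poly_def by (intro cong_sum) simp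
  then show ?thesis
    by (simp only: conj_sum[symmetric] poly_as_sum_of_monoms)
qed

text \<open>Conjugating p q* gives p* q, because conjugation is a homomorphism and an involution
  modulo x^m - 1.\<close>

lemma xm1_dvd_conj_swap:
  assumes "m \<ge> 1" "xm1 m dvd p * conj_poly m q"
  shows "xm1 m dvd q * conj_poly m p"
proof -
  have "[conj_poly m (p * conj_poly m q) = conj_poly m 0] (mod xm1 m)"
    using assms(2) by (intro conj_cong) (simp add: cong_0_iff)
  then have "[conj_poly m p * conj_poly m (conj_poly m q) = 0] (mod xm1 m)"
    by (simp add: conj_mult) (simp add: conj_poly_def)
  moreover have "[conj_poly m p * conj_poly m (conj_poly m q) = conj_poly m p * q] (mod xm1 m)"
    by (rule cong_scalar_left[OF conj_conj_cong[OF assms(1)]])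
  ultimately show ?thesis
    by (metis cong_0_iff cong_sym cong_trans mult.commute)
qed

text \<open>Each term of v at x^i is conjugated to x^(-i), which extracts coefficient i of
  u.\<close>

lemma const_mod_mult_conj:
  assumes "m \<ge> 1"
  shows "const_mod m (u * conj_poly m v) = (\<Sum>i<m. coeff (u mod xm1 m) i * coeff (v mod xm1 m) i)"
proof -
  let ?v = "v mod xm1 m"
  have "[u * conj_poly m v = u * conj_poly m ?v] (mod xm1 m)"
    by (intro cong_scalar_left conj_cong) (simp add: cong_def)
  then have "const_mod m (u * conj_poly m v) = const_mod m (u * conj_poly m ?v)"
    by (rule const_mod_cong)
  also have "u * conj_poly m ?v = u * conj_poly m (\<Sum>i<m. monom (coeff ?v i) i)"
    using poly_eq_sum_monom_lessThan[OF degree_mod_xm1_less[OF assms, of v]] by simp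
  also have "\<dots> = (\<Sum>i<m. smult (coeff ?v i) (u * monom 1 ((m - 1) * i)))"
    unfolding conj_sum conj_monom sum_distrib_left
    by (intro sum.cong refl) (metis mult_smult_right smult_monom mult.right_neutral)
  also have "const_mod m \<dots> = (\<Sum>i<m. coeff (u mod xm1 m) i * coeff ?v i)"
    unfolding const_mod_sum
    by (intro sum.cong refl)
      (simp only: const_mod_smult const_mod_mult_monom lessThan_iff mult.commute[of "coeff ?v _"])
  finally show ?thesis .
qed

section \<open>The quotient ring and its plane\<close>

lemma cring_poly_ring_rec: "cring (poly_ring_rec :: 'a::field poly ring)"
proof (rule cringI)
  show "abelian_group (poly_ring_rec :: 'a poly ring)"
    by (rule abelian_groupI)
      (auto simp: poly_ring_rec_def add.assoc add.commute intro: exI[of _ "- x" for x]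
        simp flip: eq_neg_iff_add_eq_0)
  show "comm_monoid (poly_ring_rec :: 'a poly ring)"
    by unfold_locales (auto simp: poly_ring_rec_def mult.assoc mult.commute)
qed (auto simp: poly_ring_rec_def algebra_simps)

lemma ideal_xm1: "ideal (xm1_ideal m) (poly_ring_rec :: 'a::field poly ring)"
  by (rule cring.cgenideal_ideal[OF cring_poly_ring_rec]) (simp add: poly_ring_rec_def)

lemma mem_xm1_ideal: "p \<in> xm1_ideal m \<longleftrightarrow> xm1 m dvd p"
  by (auto simp: cgenideal_def poly_ring_rec_def dvd_def mult.commute)

lemma mem_residue_class: "p \<in> residue_class m q \<longleftrightarrow> [p = q] (mod xm1 m)"
proof -
  have "p \<in> residue_class m q \<longleftrightarrow> (\<exists>h\<in>xm1_ideal m. p = h + q)"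
    by (simp add: residue_class_def a_r_coset_def') (simp add: poly_ring_rec_def)
  also have "\<dots> \<longleftrightarrow> p - q \<in> xm1_ideal m"
    by (metis add_diff_cancel_right' diff_add_cancel)
  finally show ?thesis
    by (simp add: mem_xm1_ideal cong_iff_dvd_diff)
qed

text \<open>Discharges the definite description: the remainder is the only member of the class of
  degree below m.\<close>

lemma reduced_rep_residue_class:
  assumes "m \<ge> 1"
  shows "reduced_rep m (residue_class m p) = p mod xm1 m"
  unfolding reduced_rep_def mem_residue_class
proof (rule the_equality)
  show "[p mod xm1 m = p] (mod xm1 m) \<and> degree (p mod xm1 m) < m"
    using degree_mod_xm1_less[OF assms] by (simp add: cong_def)
  show "q = p mod xm1 m" if "[q = p] (mod xm1 m) \<and> degree q < m" for q
    using that degree_xm1[OF assms, where 'a='a] by (metis cong_def mod_poly_less)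
qed

lemma carrier_quot_ring: "carrier (quot_ring m) = range (residue_class m)"
  by (auto simp: quot_ring_def FactRing_def A_RCOSETS_def' residue_class_def poly_ring_rec_def)

lemma residue_class_mult:
  "residue_class m p \<otimes>\<^bsub>quot_ring m\<^esub> residue_class m q = residue_class m (p * q)"
  using ideal.rcoset_mult_add[OF ideal_xm1, of p q m]
  by (simp add: quot_ring_def FactRing_def residue_class_def) (simp add: poly_ring_rec_def)

lemma residue_class_add:
  "residue_class m p \<oplus>\<^bsub>quot_ring m\<^esub> residue_class m q = residue_class m (p + q)"
  using ideal.a_rcos_sum[OF ideal_xm1, of p q m]
  by (simp add: quot_ring_def FactRing_def residue_class_def) (simp add: poly_ring_rec_def)

lemma zero_quot_ring: "\<zero>\<^bsub>quot_ring m\<^esub> = residue_class m 0"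
proof -
  have "p \<in> \<zero>\<^bsub>quot_ring m\<^esub> \<longleftrightarrow> p \<in> residue_class m 0" for p :: "'a poly"
    by (simp add: mem_residue_class cong_0_iff quot_ring_def FactRing_def mem_xm1_ideal)
  then show ?thesis by blast
qed

lemma one_quot_ring: "\<one>\<^bsub>quot_ring m\<^esub> = residue_class m 1"
  by (simp add: quot_ring_def FactRing_def residue_class_def) (simp add: poly_ring_rec_def)

lemmas quot_ring_simps =
  carrier_quot_ring residue_class_mult residue_class_add zero_quot_ring one_quot_ring

lemma cring_quot_ring: "cring (quot_ring m)"
  unfolding quot_ring_def by (rule ideal.quotient_is_cring[OF ideal_xm1 cring_poly_ring_rec])

section \<open>The plane as a module and the submodule generated by two pairs\<close>

lemma module_quot_plane: "Module.module (quot_ring m) (quot_plane m :: ('a::field poly set, _) module)"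
proof (rule Module.moduleI)
  show "cring (quot_ring m :: 'a poly set ring)" by (rule cring_quot_ring)
  show "abelian_group (quot_plane m :: ('a poly set, _) module)"
  proof (rule abelian_groupI)
    fix x :: "'a poly set \<times> 'a poly set" assume "x \<in> carrier (quot_plane m)"
    then obtain p q where "x = (residue_class m p, residue_class m q)"
      by (auto simp: quot_plane_def quot_ring_simps)
    then show "\<exists>y\<in>carrier (quot_plane m). y \<oplus>\<^bsub>quot_plane m\<^esub> x = \<zero>\<^bsub>quot_plane m\<^esub>"
      by (intro bexI[of _ "(residue_class m (- p), residue_class m (- q))"])
        (auto simp: quot_plane_def quot_ring_simps)
  qed (auto simp: quot_plane_def quot_ring_simps algebra_simps)
qed (auto simp: quot_plane_def quot_ring_simps algebra_simps)

lemma submodule_quot_planeI: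
  fixes N :: "('a::field poly set \<times> 'a poly set) set"
  assumes "N \<subseteq> carrier (quot_plane m)" "\<zero>\<^bsub>quot_plane m\<^esub> \<in> N"
    and "\<And>x y. x \<in> N \<Longrightarrow> y \<in> N \<Longrightarrow> x \<oplus>\<^bsub>quot_plane m\<^esub> y \<in> N"
    and smult: "\<And>a x. a \<in> carrier (quot_ring m) \<Longrightarrow> x \<in> N \<Longrightarrow> a \<odot>\<^bsub>quot_plane m\<^esub> x \<in> N"
  shows "submodule N (quot_ring m) (quot_plane m)"
proof -
  interpret Module.module "quot_ring m" "quot_plane m :: ('a poly set, _) module"
    by (rule module_quot_plane)
  show ?thesis
  proof (rule submoduleI)
    fix x assume x: "x \<in> N"
    \<comment> \<open>Closure under negation comes from the scalar -1.\<close>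
    then have "\<ominus>\<^bsub>quot_plane m\<^esub> x = (\<ominus>\<^bsub>quot_ring m\<^esub> \<one>\<^bsub>quot_ring m\<^esub>) \<odot>\<^bsub>quot_plane m\<^esub> x"
      using assms(1) by (subst smult_l_minus) auto
    then show "\<ominus>\<^bsub>quot_plane m\<^esub> x \<in> N"
      using smult[of "\<ominus>\<^bsub>quot_ring m\<^esub> \<one>\<^bsub>quot_ring m\<^esub>" x] x by simp
  qed (use assms in auto)
qed

text \<open>The combinations form the least submodule containing both pairs. Polynomial coefficients
  r and s suffice because every scalar of \<open>R\<close> is a residue class.\<close>

lemma generated_submodule_pair:
  fixes g11 g12 g21 g22 :: "'a::field poly"
  shows "generated_submodule m {(residue_class m g11, residue_class m g12),
                                (residue_class m g21, residue_class m g22)}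
    = {(residue_class m (r * g11 + s * g21), residue_class m (r * g12 + s * g22)) | r s. True}"
    (is "generated_submodule m ?G = ?N")
  unfolding generated_submodule_def
proof (rule hull_unique)
  \<comment> \<open>The coefficients 1 and 0 are spelled out so that the pairs match the set
    comprehension literally.\<close>
  have "(residue_class m (1 * g11 + 0 * g21), residue_class m (1 * g12 + 0 * g22)) \<in> ?N"
       "(residue_class m (0 * g11 + 1 * g21), residue_class m (0 * g12 + 1 * g22)) \<in> ?N"
    by blast+
  then show "?G \<subseteq> ?N" by simp
  show "submodule ?N (quot_ring m) (quot_plane m)"
  proof (rule submodule_quot_planeI)
    show "?N \<subseteq> carrier (quot_plane m)"
      by (auto simp: quot_plane_def quot_ring_simps)
    have "(residue_class m (0 * g11 + 0 * g21), residue_class m (0 * g12 + 0 * g22)) \<in> ?N"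
      by blast
    then show "\<zero>\<^bsub>quot_plane m\<^esub> \<in> ?N" by (simp add: quot_plane_def quot_ring_simps)
  next
    fix x y assume "x \<in> ?N" "y \<in> ?N"
    then obtain r s r' s' where
      "x = (residue_class m (r * g11 + s * g21), residue_class m (r * g12 + s * g22))"
      "y = (residue_class m (r' * g11 + s' * g21), residue_class m (r' * g12 + s' * g22))"
      by blast
    then have "x \<oplus>\<^bsub>quot_plane m\<^esub> y = (residue_class m ((r + r') * g11 + (s + s') * g21),
        residue_class m ((r + r') * g12 + (s + s') * g22))"
      by (simp add: quot_plane_def quot_ring_simps algebra_simps)
    then show "x \<oplus>\<^bsub>quot_plane m\<^esub> y \<in> ?N" by blast
  next
    fix a :: "'a poly set" and x
    assume "a \<in> carrier (quot_ring m)" "x \<in> ?N"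
    then obtain t r s where "a = residue_class m t"
      "x = (residue_class m (r * g11 + s * g21), residue_class m (r * g12 + s * g22))"
      by (auto simp: quot_ring_simps)
    then have "a \<odot>\<^bsub>quot_plane m\<^esub> x = (residue_class m ((t * r) * g11 + (t * s) * g21),
        residue_class m ((t * r) * g12 + (t * s) * g22))"
      by (simp add: quot_plane_def quot_ring_simps algebra_simps)
    then show "a \<odot>\<^bsub>quot_plane m\<^esub> x \<in> ?N" by blast
  qed
next
  fix M assume G: "?G \<subseteq> M" and M: "submodule M (quot_ring m) (quot_plane m)"
  interpret Module.module "quot_ring m" "quot_plane m :: ('a poly set, _) module"
    by (rule module_quot_plane)
  have "(residue_class m (r * g11 + s * g21), residue_class m (r * g12 + s * g22)) \<in> M" for r s
  proof -
    have "residue_class m r \<odot>\<^bsub>quot_plane m\<^esub> (residue_class m g11, residue_class m g12)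
        \<oplus>\<^bsub>quot_plane m\<^esub> residue_class m s \<odot>\<^bsub>quot_plane m\<^esub> (residue_class m g21, residue_class m g22) \<in> M"
      using G by (intro submoduleE(4,5)[OF M]) (auto simp: quot_ring_simps)
    then show ?thesis by (simp add: quot_plane_def quot_ring_simps)
  qed
  then show "?N \<subseteq> M" by blast
qed

section \<open>Self-orthogonality in terms of the generators\<close>

lemma euclid2_residue_class:
  assumes "m \<ge> 1"
  shows "euclid2 m (residue_class m a, residue_class m b) (residue_class m c, residue_class m d)
    = const_mod m (a * conj_poly m c + b * conj_poly m d)"
  using assms
  by (simp add: euclid2_def euclid_def reduced_rep_residue_class const_mod_mult_conj const_mod_add)

theorem theorem4p7:
  fixes m :: nat
    and g11 g12 g22 :: "'a::{field,finite} poly"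
    and C :: "('a poly set \<times> 'a poly set) set"
  assumes "m \<ge> 1"
    and "quasi_cyclic_code (2 * m) 2 (codeword m ` C)"
    and "C = generated_submodule m {(residue_class m g11, residue_class m g12),
                                    (residue_class m 0, residue_class m g22)}"
    and "g11 dvd xm1 m" and "g22 dvd xm1 m"
    and "g12 = 0 \<or> degree g12 < degree g22"
    and "g11 * g22 dvd xm1 m * g12"
  shows "C \<subseteq> euclid_dual m C \<longleftrightarrow>
      [g22 * transpose_poly m g22 = 0] (mod xm1 m)
    \<and> [g12 * transpose_poly m g22 = 0] (mod xm1 m)
    \<and> [g11 * transpose_poly m g11 + g12 * transpose_poly m g12 = 0] (mod xm1 m)"
proof -
  note m = assms(1)
  let ?X = "xm1 m :: 'a poly"
  let ?H = "g11 * conj_poly m g11 + g12 * conj_poly m g12"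
  \<comment> \<open>The Hermitian product of the codewords with coefficients (r, s) and (r', s').
    Its expansion below is governed by the four entries of the Gram matrix of the
    generators.\<close>
  define form where "form r s r' s' =
    r * g11 * conj_poly m (r' * g11) + (r * g12 + s * g22) * conj_poly m (r' * g12 + s' * g22)"
    for r s r' s'
  have form_expand: "form r s r' s' = r * conj_poly m r' * ?H
      + r * conj_poly m s' * (g12 * conj_poly m g22) + s * conj_poly m r' * (g22 * conj_poly m g12)
      + s * conj_poly m s' * (g22 * conj_poly m g22)" for r s r' s'
    by (simp add: form_def conj_add conj_mult algebra_simps)
  have conj_0_1: "conj_poly m 0 = (0 :: 'a poly)" "conj_poly m 1 = (1 :: 'a poly)"
    by (simp_all add: conj_poly_def pcompose_1)
  define word where
    "word r s = (residue_class m (r * g11), residue_class m (r * g12 + s * g22))" for r s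
  have C: "C = {word r s | r s. True}"
    unfolding assms(3) generated_submodule_pair word_def by simp
  have "C \<subseteq> carrier (quot_plane m)"
    by (auto simp: C word_def quot_plane_def quot_ring_simps)
  then have "C \<subseteq> euclid_dual m C \<longleftrightarrow> (\<forall>u\<in>C. \<forall>v\<in>C. euclid2 m u v = 0)"
    by (auto simp: euclid_dual_def)
  also have "\<dots> \<longleftrightarrow> (\<forall>r s r' s'. euclid2 m (word r s) (word r' s') = 0)"
    unfolding C by blast
  also have "\<dots> \<longleftrightarrow> (\<forall>r s r' s'. const_mod m (form r s r' s') = 0)"
    by (simp only: word_def form_def euclid2_residue_class[OF m])
  also have "\<dots> \<longleftrightarrow> ?X dvd g22 * conj_poly m g22 \<and> ?X dvd g12 * conj_poly m g22 \<and> ?X dvd ?H"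
  proof
    assume *: "\<forall>r s r' s'. const_mod m (form r s r' s') = 0"
    \<comment> \<open>Pairing t g2 with g2, t g1 with g2 and t g1 with g1 isolates one Gram entry
      each; the free multiplier t is what \<open>xm1_dvd_iff_const_mod\<close> requires.\<close>
    have "const_mod m (t * (g22 * conj_poly m g22)) = 0" "const_mod m (t * (g12 * conj_poly m g22)) = 0"
      "const_mod m (t * ?H) = 0" for t
      using *[rule_format, of 0 t 0 1] *[rule_format, of t 0 0 1] *[rule_format, of t 0 1 0]
      by (simp_all add: form_expand conj_0_1)
    then show "?X dvd g22 * conj_poly m g22 \<and> ?X dvd g12 * conj_poly m g22 \<and> ?X dvd ?H"
      unfolding xm1_dvd_iff_const_mod[OF m] by blast
  next
    assume *: "?X dvd g22 * conj_poly m g22 \<and> ?X dvd g12 * conj_poly m g22 \<and> ?X dvd ?H"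
    \<comment> \<open>The fourth Gram entry is the conjugate of the mixed entry in the second
      condition.\<close>
    then have "?X dvd g22 * conj_poly m g12"
      using xm1_dvd_conj_swap[OF m] by blast
    with * have "?X dvd form r s r' s'" for r s r' s'
      unfolding form_expand by (meson dvd_add dvd_mult)
    then show "\<forall>r s r' s'. const_mod m (form r s r' s') = 0"
      by (simp add: const_mod_def dvd_eq_mod_eq_0)
  qed
  also have "\<dots> \<longleftrightarrow> [g22 * transpose_poly m g22 = 0] (mod ?X)
    \<and> [g12 * transpose_poly m g22 = 0] (mod ?X)
    \<and> [g11 * transpose_poly m g11 + g12 * transpose_poly m g12 = 0] (mod ?X)"
  proof -
    \<comment> \<open>Divisors of the nonzero polynomial x^m - 1 have degree at most m, and
      \<open>g12\<close> inherits the bound from \<open>g22\<close>, so all three transposes are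
      within the range of \<open>transpose_cong_conj\<close>.\<close>
    have deg: "degree g11 \<le> m" "degree g22 \<le> m"
      using dvd_imp_degree_le[OF assms(4) xm1_neq_0[OF m]]
        dvd_imp_degree_le[OF assms(5) xm1_neq_0[OF m]] by (simp_all add: degree_xm1[OF m])
    with assms(6) have "degree g12 \<le> m" by auto
    note t = transpose_cong_conj[OF deg(1)] transpose_cong_conj[OF this] transpose_cong_conj[OF deg(2)]
    have "[g22 * transpose_poly m g22 = g22 * conj_poly m g22] (mod ?X)"
      "[g12 * transpose_poly m g22 = g12 * conj_poly m g22] (mod ?X)"
      "[g11 * transpose_poly m g11 + g12 * transpose_poly m g12 = ?H] (mod ?X)"
      by (intro cong_add cong_scalar_left t)+
    then show ?thesis
      by (simp only: cong_0_iff[symmetric] cong_def)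
  qed
  finally show ?thesis .
qed

end
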